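(* Let $d\in\mathbb{N}$, $d\ge 1$, $p\in(1,\infty)$ and $m>0$ satisfy $m(p-1)>1$ and $dp>d+1$. Let $o\in\mathbb{R}^d$, let $X$ be a probabilistically weak solution (as defined in the context) starting at $o$, and set $Y_t:=|X_t-o|/t^{1/\beta}$ for $t>0$. Then for every $t>0$ the law of $Y_t$ under $\mathbf{P}^o$ equals $V\,\mathscr{L}^1$, where $V:\mathbb{R}\to[0,\infty)$ is $$V(r):=\begin{cases}\omega_{d-1}\,\max\{C-\kappa\,r^{p/(p-1)},0\}^\gamma\,r^{d-1}&\text{if }r\ge0,\\0&\text{otherwise};\end{cases}$$ in particular, it does not depend on $t$.
   Context: Parameters: $\beta:=p+d(m(p-1)-1)$, $\gamma:=\frac{p-1}{m(p-1)-1}$, $\kappa:=\frac{m(p-1)-1}{mp}\beta^{-1/(p-1)}$, all positive. $\omega_{d-1}$ is the area of the unit sphere in $\mathbb{R}^d$ ($\omega_0=2$). $\mathscr{L}^k$ is Lebesgue measure on $\mathbb{R}^k$. Barenblatt profile: for $t>0$, $r\ge 0$, $S(t,r):=C-\kappa[t^{-1/\beta}r]^{p/(p-1)}$ and $U(t,r):=t^{-d/\beta}\,\max\{S(t,r),0\}^\gamma$, where $C>0$ is the unique constant (depending only on $d,p,m$) such that $\omega_{d-1}\int_0^\infty U(t,r)r^{d-1}\,\mathrm{d}r=1$ for every $t>0$. Put $\rho:=(C/\kappa)^{(p-1)/p}$; the support of $U(t,\cdot)$ is $[0,\rho t^{1/\beta}]$. The Barenblatt solution is $w^x(t,y):=U(t,|y-x|)$.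 Coefficients: for $0<r<\rho t^{1/\beta}$ let $a(t,r):=m^{p-1}|\partial_rU(t,r)|^{p-2}U(t,r)^{(m-1)(p-1)}$ and $a_r:=\partial_r a$; set $a(t,r):=a_r(t,r):=0$ for $r\ge\rho t^{1/\beta}$ and for $r=0$. For $z\in\mathbb{R}^d$, $\mathrm{sgn}\,z:=z/|z|$ if $z\ne0$, $\mathrm{sgn}\,0:=0$. A stochastic basis is a complete probability space $(\Omega,\mathscr{F},\mathbf{P}^x)$ with a right-continuous filtration $\mathscr{F}_\bullet$ augmented by null sets; $\mathbf{E}^x$ denotes expectation. A probabilistically weak solution starting at $x\in\mathbb{R}^d$ is a continuous $\mathscr{F}_\bullet$-adapted $\mathbb{R}^d$-valued process $X$ on a stochastic basis carrying a standard $d$-dimensional $\mathscr{F}_\bullet$-Brownian motion $W$ such that (a) $\mathbf{E}^x[\int_0^t a(s,|X_s-x|)\,\mathrm{d}s]<\infty$ and $\mathbf{E}^x[\int_0^t|a_r(s,|X_s-x|)|\,\mathrm{d}s]<\infty$ for every $t>0$; (b) $\mathbf{P}^x$-a.s., for all $t\ge0$, $X_t=X_0+\int_0^t\sqrt{2a(s,|X_s-x|)}\,\mathrm{d}W_s+\int_0^t a_r(s,|X_s-x|)\,\mathrm{sgn}(X_s-x)\,\mathrm{d}s$; (c) for every $t>0$ the law of $X_t$ is $w^x(t,\cdot)\,\mathscr{L}^d$; consequently $X_0=x$ a.s. *)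

theory Defs
  imports "HOL-Probability.Probability"
begin

section \<open>Parameters and the Barenblatt solution\<close>

text \<open>
  The area of the unit sphere in a \<open>d\<close>-dimensional Euclidean space is the derivative at \<open>r = 1\<close> of
  the volume \<open>unit_ball_vol d * r ^ d\<close> of the ball of radius \<open>r\<close>.
\<close>

definition sphere_area :: "nat \<Rightarrow> real" where
  "sphere_area d = real d * unit_ball_vol (real d)"

lemma sphere_area_eq_deriv_ball_volume:
  "((\<lambda>r. measure lborel (ball (0 :: 'a::euclidean_space) r))
     has_real_derivative sphere_area DIM('a)) (at 1)"
proof -
  have "((\<lambda>r. unit_ball_vol (real DIM('a)) * r ^ DIM('a))
          has_real_derivative sphere_area DIM('a)) (at 1)"
    by (auto intro!: derivative_eq_intros simp: sphere_area_def)
  then show ?thesis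
    by (rule has_field_derivative_transform_within[where d = 1])
       (auto simp: content_ball dist_real_def)
qed

lemma sphere_area_Gamma:
  assumes "d \<ge> 1"
  shows "sphere_area d = 2 * pi powr (real d / 2) / Gamma (real d / 2)"
proof -
  have *: "Gamma (real d / 2 + 1) = real d / 2 * Gamma (real d / 2)"
    using assms by (intro Gamma_plus1) auto
  show ?thesis
    using assms unfolding sphere_area_def unit_ball_vol_def * by simp
qed

lemma sphere_area_1: "sphere_area 1 = 2"
  using sphere_area_Gamma[of 1] by (simp add: Gamma_one_half_real powr_half_sqrt)

definition barenblatt_beta :: "nat \<Rightarrow> real \<Rightarrow> real \<Rightarrow> real" where
  "barenblatt_beta d p m = p + real d * (m * (p - 1) - 1)"

definition barenblatt_gamma :: "real \<Rightarrow> real \<Rightarrow> real" where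
  "barenblatt_gamma p m = (p - 1) / (m * (p - 1) - 1)"

definition barenblatt_kappa :: "nat \<Rightarrow> real \<Rightarrow> real \<Rightarrow> real" where
  "barenblatt_kappa d p m =
     (m * (p - 1) - 1) / (m * p) * barenblatt_beta d p m powr (- 1 / (p - 1))"

text \<open>\<open>S\<close> and \<open>U\<close> with the constant \<open>C\<close> still free.\<close>

definition barenblatt_S_of :: "real \<Rightarrow> nat \<Rightarrow> real \<Rightarrow> real \<Rightarrow> real \<Rightarrow> real \<Rightarrow> real" where
  "barenblatt_S_of C d p m t r =
     C - barenblatt_kappa d p m * (t powr (- 1 / barenblatt_beta d p m) * r) powr (p / (p - 1))"

definition barenblatt_U_of :: "real \<Rightarrow> nat \<Rightarrow> real \<Rightarrow> real \<Rightarrow> real \<Rightarrow> real \<Rightarrow> real" where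
  "barenblatt_U_of C d p m t r =
     t powr (- real d / barenblatt_beta d p m) *
     (max (barenblatt_S_of C d p m t r) 0) powr barenblatt_gamma p m"

definition barenblatt_C :: "nat \<Rightarrow> real \<Rightarrow> real \<Rightarrow> real" where
  "barenblatt_C d p m =
     (THE C. C > 0 \<and>
        (\<forall>t>0. sphere_area d * (LBINT r:{0..}. barenblatt_U_of C d p m t r * r ^ (d - 1)) = 1))"

definition barenblatt_U :: "nat \<Rightarrow> real \<Rightarrow> real \<Rightarrow> real \<Rightarrow> real \<Rightarrow> real" where
  "barenblatt_U d p m = barenblatt_U_of (barenblatt_C d p m) d p m"

definition barenblatt_rho :: "nat \<Rightarrow> real \<Rightarrow> real \<Rightarrow> real" where
  "barenblatt_rho d p m = (barenblatt_C d p m / barenblatt_kappa d p m) powr ((p - 1) / p)"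

definition barenblatt_w :: "real \<Rightarrow> real \<Rightarrow> real ^ 'd \<Rightarrow> real \<Rightarrow> real ^ 'd \<Rightarrow> real" where
  "barenblatt_w p m x t y = barenblatt_U CARD('d) p m t (norm (y - x))"

section \<open>Coefficients\<close>

definition coeff_a :: "nat \<Rightarrow> real \<Rightarrow> real \<Rightarrow> real \<Rightarrow> real \<Rightarrow> real" where
  "coeff_a d p m t r =
     (if 0 < r \<and> r < barenblatt_rho d p m * t powr (1 / barenblatt_beta d p m)
      then m powr (p - 1) * \<bar>deriv (barenblatt_U d p m t) r\<bar> powr (p - 2) *
           barenblatt_U d p m t r powr ((m - 1) * (p - 1))
      else 0)"

definition coeff_ar :: "nat \<Rightarrow> real \<Rightarrow> real \<Rightarrow> real \<Rightarrow> real \<Rightarrow> real" where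
  "coeff_ar d p m t r =
     (if 0 < r \<and> r < barenblatt_rho d p m * t powr (1 / barenblatt_beta d p m)
      then deriv (coeff_a d p m t) r
      else 0)"

section \<open>Stochastic bases, Brownian motion and the Ito integral\<close>

text \<open>
  Time is the half line \<open>{0..}\<close> inside \<^typ>\<open>real\<close>; filtrations and processes are never inspected at
  negative times.
\<close>

definition stochastic_basis :: "'w measure \<Rightarrow> (real \<Rightarrow> 'w measure) \<Rightarrow> bool" where
  "stochastic_basis M F \<longleftrightarrow>
     prob_space M \<and> complete_measure M \<and>
     (\<forall>t\<ge>0. subalgebra M (F t)) \<and>
     (\<forall>s\<ge>0. \<forall>t\<ge>s. sets (F s) \<subseteq> sets (F t)) \<and>
     (\<forall>t\<ge>0. sets (F t) = (\<Inter>s\<in>{t<..}. sets (F s))) \<and>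
     null_sets M \<subseteq> sets (F 0)"

definition adapted ::
  "(real \<Rightarrow> 'w measure) \<Rightarrow> (real \<Rightarrow> 'w \<Rightarrow> 'b::topological_space) \<Rightarrow> bool" where
  "adapted F X \<longleftrightarrow> (\<forall>t\<ge>0. X t \<in> borel_measurable (F t))"

definition continuous_process ::
  "'w measure \<Rightarrow> (real \<Rightarrow> 'w \<Rightarrow> 'b::topological_space) \<Rightarrow> bool" where
  "continuous_process M X \<longleftrightarrow> (\<forall>\<omega>\<in>space M. continuous_on {0..} (\<lambda>t. X t \<omega>))"

definition progressively_measurable ::
  "(real \<Rightarrow> 'w measure) \<Rightarrow> (real \<Rightarrow> 'w \<Rightarrow> 'b::topological_space) \<Rightarrow> bool" where
  "progressively_measurable F H \<longleftrightarrow>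
     (\<forall>t\<ge>0. (\<lambda>(s, \<omega>). H s \<omega>) \<in> borel_measurable (restrict_space borel {0..t} \<Otimes>\<^sub>M F t))"

definition brownian_motion ::
  "'w measure \<Rightarrow> (real \<Rightarrow> 'w measure) \<Rightarrow> (real \<Rightarrow> 'w \<Rightarrow> real ^ 'd) \<Rightarrow> bool" where
  "brownian_motion M F W \<longleftrightarrow>
     adapted F W \<and> continuous_process M W \<and> (AE \<omega> in M. W 0 \<omega> = 0) \<and>
     (\<forall>s\<ge>0. \<forall>t>s.
        prob_space.indep_set M (sets (F s))
          (sets (vimage_algebra (space M) (\<lambda>\<omega>. W t \<omega> - W s \<omega>) borel)) \<and>
        distributed M lborel (\<lambda>\<omega>. W t \<omega> - W s \<omega>)
          (\<lambda>y. ennreal (\<Prod>i\<in>UNIV. normal_density 0 (sqrt (t - s)) (y $ i))))"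

text \<open>
  The triple \<open>(n, \<tau>, \<xi>)\<close> encodes the simple process \<open>\<Sum>i<n. \<xi> i * indicator {\<tau> i<..\<tau> (i + 1)}\<close>.
\<close>

definition simple_integrand ::
  "'w measure \<Rightarrow> (real \<Rightarrow> 'w measure) \<Rightarrow> nat \<times> (nat \<Rightarrow> real) \<times> (nat \<Rightarrow> 'w \<Rightarrow> real) \<Rightarrow> bool" where
  "simple_integrand M F = (\<lambda>(n, \<tau>, \<xi>).
     0 \<le> \<tau> 0 \<and> (\<forall>i<n. \<tau> i \<le> \<tau> (Suc i)) \<and>
     (\<forall>i<n. \<xi> i \<in> borel_measurable (F (\<tau> i)) \<and> (\<exists>B. \<forall>\<omega>\<in>space M. \<bar>\<xi> i \<omega>\<bar> \<le> B)))"

definition simple_value ::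
  "nat \<times> (nat \<Rightarrow> real) \<times> (nat \<Rightarrow> 'w \<Rightarrow> real) \<Rightarrow> real \<Rightarrow> 'w \<Rightarrow> real" where
  "simple_value = (\<lambda>(n, \<tau>, \<xi>) s \<omega>. \<Sum>i<n. \<xi> i \<omega> * indicator {\<tau> i<..\<tau> (Suc i)} s)"

definition simple_integral ::
  "(real \<Rightarrow> 'w \<Rightarrow> real ^ 'd) \<Rightarrow> nat \<times> (nat \<Rightarrow> real) \<times> (nat \<Rightarrow> 'w \<Rightarrow> real) \<Rightarrow>
   real \<Rightarrow> 'w \<Rightarrow> real ^ 'd" where
  "simple_integral W = (\<lambda>(n, \<tau>, \<xi>) t \<omega>.
     \<Sum>i<n. \<xi> i \<omega> *\<^sub>R (W (min t (\<tau> (Suc i))) \<omega> - W (min t (\<tau> i)) \<omega>))"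

definition converges_to_0_in_prob :: "'w measure \<Rightarrow> (nat \<Rightarrow> 'w \<Rightarrow> ennreal) \<Rightarrow> bool" where
  "converges_to_0_in_prob M Z \<longleftrightarrow>
     (\<forall>n. Z n \<in> borel_measurable M) \<and>
     (\<forall>\<epsilon>>0. (\<lambda>n. measure M {\<omega> \<in> space M. Z n \<omega> > \<epsilon>}) \<longlonglongrightarrow> 0)"

text \<open>
  \<open>is_ito_integral M F W H I\<close> says that \<open>I\<close> is a continuous version of the process
  \<open>\<integral>\<^sub>0\<^sup>t H\<^sub>s dW\<^sub>s\<close> for a scalar integrand \<open>H\<close> with almost surely locally square integrable paths and a
  vector-valued \<open>W\<close>: it is the limit, locally uniformly in time in probability, of the
  elementary integrals of simple processes approximating \<open>H\<close> in \<open>L\<^sup>2([0,t])\<close> in probability. For a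
  Brownian motion \<open>W\<close> such an \<open>I\<close> exists, does not depend on the approximating sequence and is
  unique up to indistinguishability, so a relation replaces an operator.
\<close>

definition is_ito_integral ::
  "'w measure \<Rightarrow> (real \<Rightarrow> 'w measure) \<Rightarrow> (real \<Rightarrow> 'w \<Rightarrow> real ^ 'd) \<Rightarrow>
   (real \<Rightarrow> 'w \<Rightarrow> real) \<Rightarrow> (real \<Rightarrow> 'w \<Rightarrow> real ^ 'd) \<Rightarrow> bool" where
  "is_ito_integral M F W H I \<longleftrightarrow>
     progressively_measurable F H \<and>
     (AE \<omega> in M. \<forall>t\<ge>0. (\<integral>\<^sup>+ s\<in>{0..t}. ennreal ((H s \<omega>)\<^sup>2) \<partial>lborel) < \<infinity>) \<and>
     adapted F I \<and> continuous_process M I \<and>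
     (\<exists>\<phi>. (\<forall>n. simple_integrand M F (\<phi> n)) \<and>
        (\<forall>t\<ge>0. converges_to_0_in_prob M
           (\<lambda>n \<omega>. \<integral>\<^sup>+ s\<in>{0..t}. ennreal ((simple_value (\<phi> n) s \<omega> - H s \<omega>)\<^sup>2) \<partial>lborel)) \<and>
        (\<forall>t\<ge>0. converges_to_0_in_prob M
           (\<lambda>n \<omega>. SUP s\<in>{0..t}. ennreal (norm (simple_integral W (\<phi> n) s \<omega> - I s \<omega>)))))"

section \<open>Probabilistically weak solutions\<close>

text \<open>
  The initial condition \<open>X 0 = x\<close> almost surely is not listed: it follows from the one-dimensional
  marginals and path continuity. The function \<^const>\<open>sgn\<close> on \<^typ>\<open>real ^ 'd\<close> is \<open>z / |z|\<close>, and \<open>0\<close>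
  at \<open>0\<close>. The Bochner integral in the drift exists almost surely by the second integrability
  condition.
\<close>

definition weak_solution ::
  "real \<Rightarrow> real \<Rightarrow> real ^ 'd \<Rightarrow> 'w measure \<Rightarrow> (real \<Rightarrow> 'w measure) \<Rightarrow>
   (real \<Rightarrow> 'w \<Rightarrow> real ^ 'd) \<Rightarrow> (real \<Rightarrow> 'w \<Rightarrow> real ^ 'd) \<Rightarrow> bool" where
  "weak_solution p m x M F W X \<longleftrightarrow>
     stochastic_basis M F \<and> brownian_motion M F W \<and>
     adapted F X \<and> continuous_process M X \<and>
     (\<forall>t>0. (\<integral>\<^sup>+ \<omega>. (\<integral>\<^sup>+ s\<in>{0..t}. ennreal (coeff_a CARD('d) p m s (norm (X s \<omega> - x))) \<partial>lborel) \<partial>M) < \<infinity>) \<and>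
     (\<forall>t>0. (\<integral>\<^sup>+ \<omega>. (\<integral>\<^sup>+ s\<in>{0..t}. ennreal \<bar>coeff_ar CARD('d) p m s (norm (X s \<omega> - x))\<bar> \<partial>lborel) \<partial>M) < \<infinity>) \<and>
     (\<exists>I. is_ito_integral M F W
            (\<lambda>s \<omega>. sqrt (2 * coeff_a CARD('d) p m s (norm (X s \<omega> - x)))) I \<and>
          (AE \<omega> in M. \<forall>t\<ge>0.
             X t \<omega> = X 0 \<omega> + I t \<omega> +
               (LINT s:{0..t}|lborel.
                  coeff_ar CARD('d) p m s (norm (X s \<omega> - x)) *\<^sub>R sgn (X s \<omega> - x)))) \<and>
     (\<forall>t>0. distributed M lborel (X t) (\<lambda>y. ennreal (barenblatt_w p m x t y)))"

section \<open>The density of the rescaled radial process\<close>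

definition radial_density :: "nat \<Rightarrow> real \<Rightarrow> real \<Rightarrow> real \<Rightarrow> real" where
  "radial_density d p m r =
     (if r \<ge> 0
      then sphere_area d *
           (max (barenblatt_C d p m - barenblatt_kappa d p m * r powr (p / (p - 1))) 0)
             powr barenblatt_gamma p m *
           r ^ (d - 1)
      else 0)"

end

(*
  Pushing Lebesgue measure forward along the norm gives the measure with density
  sphere_area d * r ^ (d - 1) on the half line, since both measures assign the volume of a ball to
  {..r}. Hence |X_t - o| has density omega_{d-1} U(t,r) r^{d-1}, and the self-similarity of U
  removes t after dividing by t^{1/beta}.
*)
theory Submission
  imports Defs
begin

text \<open>Integration in polar coordinates for radial functions, phrased as an identity of
  push-forward measures: only ball volumes are compared, and no measure on the sphere has to be
  constructed.\<close>

lemma distr_norm_lborel: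
  "distr lborel borel (norm :: 'a::euclidean_space \<Rightarrow> real) =
   density lborel
     (\<lambda>r. ennreal (indicator {0..} r * (sphere_area DIM('a) * r ^ (DIM('a) - 1))))"
    (is "?M = density lborel ?f")
proof -
  have cball: "emeasure ?M {..r} = emeasure (density lborel ?f) {..r}"
    and fin: "emeasure ?M {..r} \<noteq> \<infinity>" for r
  proof -
    have M: "emeasure ?M {..r} = emeasure lborel (cball (0 :: 'a) r)"
      by (subst emeasure_distr) (auto intro!: arg_cong[where f = "emeasure lborel"])
    then show "emeasure ?M {..r} \<noteq> \<infinity>"
      using emeasure_lborel_cball_finite[of "0 :: 'a" r] by simp
    show "emeasure ?M {..r} = emeasure (density lborel ?f) {..r}"
    proof (cases "0 \<le> r")
      case True
      have "emeasure (density lborel ?f) {..r} =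
          (\<integral>\<^sup>+ s. ennreal (sphere_area DIM('a) * s ^ (DIM('a) - 1)) * indicator {0..r} s \<partial>lborel)"
        by (subst emeasure_density) (auto intro!: nn_integral_cong simp: indicator_def)
      \<comment> \<open>The antiderivative is the volume of the ball of radius \<open>s\<close>; its
        value at 0 vanishes because \<open>DIM('a)\<close> is positive.\<close>
      also have "\<dots> = ennreal (unit_ball_vol DIM('a) * r ^ DIM('a) - unit_ball_vol DIM('a) * 0 ^ DIM('a))"
        using True
        by (intro nn_integral_FTC_Icc)
           (auto intro!: derivative_eq_intros mult_nonneg_nonneg
              simp: sphere_area_def simp flip: has_real_derivative_iff_has_vector_derivative)
      finally show ?thesis
        using True by (simp add: M emeasure_cball)
    next
      case False
      then have "emeasure (density lborel ?f) {..r} = 0"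
        by (subst emeasure_density)
           (auto intro!: nn_integral_zero' simp: indicator_def)
      with False show ?thesis
        by (simp add: M)
    qed
  qed
  show ?thesis
  \<comment> \<open>Half-lines are closed under intersection and generate the Borel sets. Both
    measures are infinite in total, so uniqueness also needs the exhaustion by the sets
    \<open>{..real i}\<close> and the finiteness in \<open>fin\<close>.\<close>
  proof (rule measure_eqI_generator_eq[where E = "range atMost" and \<Omega> = UNIV
        and A = "\<lambda>i. {..real i}"])
    show "Int_stable (range (atMost :: real \<Rightarrow> _))"
      by (auto simp: Int_stable_def)
    show "(\<Union>i. {..real i}) = UNIV"
      using real_arch_simple by auto
  qed (use cball fin in \<open>auto simp: borel_eq_atMost\<close>)
qed

text \<open>A density depending on \<open>y\<close> only through \<open>norm (y - x)\<close> can be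
  pulled out of the push-forward along that map; translation invariance then leaves the image of
  Lebesgue measure under \<open>norm\<close>.\<close>

lemma distributed_norm_diff:
  fixes Z :: "'w \<Rightarrow> 'a::euclidean_space"
  assumes Z: "distributed M lborel Z (\<lambda>y. ennreal (f (norm (y - x))))"
    and f: "f \<in> borel_measurable borel"
  shows "distributed M lborel (\<lambda>\<omega>. norm (Z \<omega> - x))
    (\<lambda>r. ennreal (indicator {0..} r * (sphere_area DIM('a) * r ^ (DIM('a) - 1)) * f r))"
    (is "distributed M lborel ?R ?g")
proof -
  note f[measurable]
  have [measurable]: "Z \<in> borel_measurable M"
    using distributed_measurable[OF Z] by simp
  have "distr M lborel ?R = distr (distr M lborel Z) borel (\<lambda>y. norm (y - x))"
    by (subst distr_distr) (auto simp: comp_def intro!: distr_cong)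
  also have "\<dots> = distr (density lborel (\<lambda>y. ennreal (f (norm (y - x))))) borel (\<lambda>y. norm (y - x))"
    by (simp add: distributed_distr_eq_density[OF Z])
  also have "\<dots> = density (distr lborel borel (\<lambda>y. norm (y - x))) (\<lambda>r. ennreal (f r))"
    by (subst density_distr) auto
  also have "distr lborel borel (\<lambda>y. norm (y - x)) =
      distr (distr lborel borel ((+) (- x))) borel (norm :: 'a \<Rightarrow> real)"
    by (subst distr_distr) (auto simp: comp_def)
  also have "\<dots> = distr lborel borel (norm :: 'a \<Rightarrow> real)"
    by (simp add: lborel_distr_plus)
  also have "density (distr lborel borel (norm :: 'a \<Rightarrow> real)) (\<lambda>r. ennreal (f r)) = density lborel ?g"
    unfolding distr_norm_lborel
    \<comment> \<open>\<open>ennreal_mult'\<close> asks for nonnegativity of the first factor, which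
      here is the geometric one.\<close>
    by (subst density_density_eq)
       (auto intro!: density_cong simp: sphere_area_def indicator_def simp flip: ennreal_mult')
  finally show ?thesis
    unfolding distributed_def by simp
qed

text \<open>Self-similarity: inside the profile, \<open>c\<close> cancels
  \<open>t powr (- 1 / \<beta>)\<close>. The prefactor \<open>inverse (c ^ d)\<close> is absorbed by
  \<open>c ^ (d - 1)\<close> from the surface factor and the last \<open>c\<close>, which is the
  Jacobian of the substitution.\<close>

lemma radial_density_rescale:
  fixes p m :: real
  assumes "0 < t" "0 < d"
  defines "c \<equiv> t powr (1 / barenblatt_beta d p m)"
  shows "radial_density d p m r =
    indicator {0..} (c * r) * (sphere_area d * (c * r) ^ (d - 1)) * barenblatt_U d p m t (c * r) * c"
proof (cases "0 \<le> r")
  case True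
  have c: "0 < c" using assms by simp
  have inv: "t powr (- 1 / barenblatt_beta d p m) = inverse c"
    by (simp add: c_def flip: powr_minus)
  have "t powr (- real d / barenblatt_beta d p m) = c powr (- real d)"
    by (simp add: c_def powr_powr)
  also have "\<dots> = inverse (c ^ d)"
    using c by (simp add: powr_minus powr_realpow)
  finally have inv_d: "t powr (- real d / barenblatt_beta d p m) = inverse (c ^ d)" .
  have U: "barenblatt_U d p m t (c * r) =
      inverse (c ^ d) * max (barenblatt_C d p m - barenblatt_kappa d p m * r powr (p / (p - 1))) 0
        powr barenblatt_gamma p m"
    using c unfolding barenblatt_U_def barenblatt_U_of_def barenblatt_S_of_def inv inv_d
    by (simp flip: mult.assoc)
  \<comment> \<open>Here \<open>0 < d\<close> matters: with truncated subtraction,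
    \<open>c ^ (d - 1) * c = c ^ d\<close> relies on it.\<close>
  have pow: "r ^ (d - Suc 0) = (c * r) ^ (d - Suc 0) * (inverse (c ^ d) * c)"
    using c assms(2) by (cases d) (auto simp: field_simps)
  have ind: "indicator {0..} (c * r) = (1 :: real)"
    using True c by simp
  show ?thesis
    using True pow unfolding U ind by (simp add: radial_density_def)
next
  case False
  then show ?thesis
    using assms by (simp add: radial_density_def indicator_def zero_le_mult_iff)
qed

theorem proposition3p20:
  fixes p m :: real
    and x0 :: "real ^ 'd"
    and M :: "'w measure"
    and F :: "real \<Rightarrow> 'w measure"
    and W X :: "real \<Rightarrow> 'w \<Rightarrow> real ^ 'd"
  assumes "1 < p" and "0 < m"
    and "m * (p - 1) > 1"
    and "real CARD('d) * p > real CARD('d) + 1"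
    and "weak_solution p m x0 M F W X"
  shows "(\<forall>t>0. distributed M lborel
              (\<lambda>\<omega>. norm (X t \<omega> - x0) / t powr (1 / barenblatt_beta CARD('d) p m))
              (\<lambda>r. ennreal (radial_density CARD('d) p m r))) \<and>
         (\<forall>s>0. \<forall>t>0.
            distr M lborel (\<lambda>\<omega>. norm (X s \<omega> - x0) / s powr (1 / barenblatt_beta CARD('d) p m)) =
            distr M lborel (\<lambda>\<omega>. norm (X t \<omega> - x0) / t powr (1 / barenblatt_beta CARD('d) p m)))"
proof -
  let ?Y = "\<lambda>t \<omega>. norm (X t \<omega> - x0) / t powr (1 / barenblatt_beta CARD('d) p m)"
  have Y: "distributed M lborel (?Y t) (\<lambda>r. ennreal (radial_density CARD('d) p m r))"
    if t: "0 < t" for t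
  proof -
    interpret prob_space M
      using assms(5) by (simp add: weak_solution_def stochastic_basis_def)
    define c where "c = t powr (1 / barenblatt_beta CARD('d) p m)"
    have c: "0 < c" using t by (simp add: c_def)
    have X: "distributed M lborel (X t)
        (\<lambda>y. ennreal (barenblatt_U CARD('d) p m t (norm (y - x0))))"
      using assms(5) t by (simp add: weak_solution_def barenblatt_w_def)
    have "distributed M lborel (\<lambda>\<omega>. norm (X t \<omega> - x0))
        (\<lambda>r. ennreal (indicator {0..} r * (sphere_area CARD('d) * r ^ (CARD('d) - 1)) *
           barenblatt_U CARD('d) p m t r))"
      \<comment> \<open>Unfolding \<open>barenblatt_U\<close> makes its Borel measurability in the
        radius, the remaining premise, evident.\<close>
      using distributed_norm_diff[OF X]
      by (simp add: barenblatt_U_def barenblatt_U_of_def barenblatt_S_of_def)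
    \<comment> \<open>Scaling by \<open>inverse c\<close> without shift turns a density
      \<open>g\<close> into \<open>g (c * r) / inverse c\<close>; this division supplies the last
      factor \<open>c\<close> of \<open>radial_density_rescale\<close>.\<close>
    note distributed_affine[OF this, of "inverse c" 0]
    moreover have "ennreal (indicator {0..} (c * r) * (sphere_area CARD('d) * (c * r) ^ (CARD('d) - 1)) *
           barenblatt_U CARD('d) p m t (c * r)) / ennreal (inverse c) =
        ennreal (radial_density CARD('d) p m r)" for r
      unfolding radial_density_rescale[OF t zero_less_card_finite] c_def[symmetric]
      using c
      by (subst divide_ennreal)
         (auto intro!: mult_nonneg_nonneg zero_le_power
            simp: sphere_area_def indicator_def barenblatt_U_def barenblatt_U_of_def divide_inverse)
    ultimately show ?thesis
      unfolding c_def[symmetric] using c by (simp add: divide_inverse mult.commute)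
  qed
  then show ?thesis
    by (simp add: distributed_distr_eq_density[OF Y])
qed

end
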